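(* Let $H=(V,E)$ be a finite hypergraph with $\operatorname{rank}(H)=t\geq 1$, and let $d$ be an integer such that no edge of $H$ intersects more than $d$ other edges of $H$. Then for every integer $v\ge 2$, \[ {\rm VCAN}(H,v)\;\le\;\left\lceil \frac{\ln(d+1)+t\ln v+1}{\ln\frac{v^t}{v^t-1}}\right\rceil\;\le\;\left\lceil v^t\bigl(\ln(d+1)+t\ln v+1\bigr)\right\rceil . \]
   Context: For a hypergraph $H=(V,E)$, $\operatorname{rank}(H)$ is the largest cardinality of an edge of $H$. Let $k=|V|$ and $v\ge 2$. A variable-strength covering array ${\rm VCA}(n;H,v)$ is an $n\times k$ array with entries from $\mathbb{Z}_v$, columns indexed by $V$, such that for every edge $e=\{v_0,\dots,v_{s-1}\}\in E$ the $n\times s$ subarray formed by the columns indexed by $e$ contains every $s$-tuple of $\mathbb{Z}_v^s$ as a row at least once. ${\rm VCAN}(H,v)$ is the smallest $n$ for which a ${\rm VCA}(n;H,v)$ exists. Two edges intersect if they share at least one vertex; $\ln$ is the natural logarithm. *)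

theory Defs
  imports Complex_Main "HOL-Library.FuncSet"
begin

definition finite_hypergraph :: "'a set \<Rightarrow> 'a set set \<Rightarrow> bool" where
  "finite_hypergraph V E \<longleftrightarrow> finite V \<and> E \<subseteq> Pow V"

(* An edgeless hypergraph gets rank 0, so that a rank of at least 1 entails
   the existence of an edge. *)
definition hypergraph_rank :: "'a set set \<Rightarrow> nat" where
  "hypergraph_rank E = (if E = {} then 0 else Max (card ` E))"

(* The entry in row i and column x is A i x; only i < n and x in V matter.
   The ring of integers modulo v is represented by its residues {..<v}, and an
   s-tuple over it, for an edge e with s vertices, by a function from e to {..<v},
   which avoids choosing an enumeration of e. *)
definition VCA :: "nat \<Rightarrow> 'a set \<Rightarrow> 'a set set \<Rightarrow> nat \<Rightarrow> (nat \<Rightarrow> 'a \<Rightarrow> nat) \<Rightarrow> bool" where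
  "VCA n V E v A \<longleftrightarrow>
     (\<forall>i<n. \<forall>x\<in>V. A i x \<in> {..<v}) \<and>
     (\<forall>e\<in>E. \<forall>f \<in> e \<rightarrow>\<^sub>E {..<v}. \<exists>i<n. \<forall>x\<in>e. A i x = f x)"

definition VCAN :: "'a set \<Rightarrow> 'a set set \<Rightarrow> nat \<Rightarrow> nat" where
  "VCAN V E v = (LEAST n. \<exists>A. VCA n V E v A)"

(* The minimum in VCAN is attained: list all rows over V. *)
lemma VCA_exists:
  fixes V :: "'a set" and v :: nat
  assumes "finite_hypergraph V E" and "v \<ge> 2"
  shows "\<exists>n A. VCA n V E v A"
proof -
  have fin: "finite V" and sub: "E \<subseteq> Pow V"
    using assms(1) by (auto simp: finite_hypergraph_def)
  let ?R = "V \<rightarrow>\<^sub>E {..<v}"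
  have fR: "finite ?R" using fin by (simp add: finite_PiE)
  obtain A :: "nat \<Rightarrow> 'a \<Rightarrow> nat" and n where A: "?R = A ` {i. i < n}"
    using finite_imp_nat_seg_image_inj_on[OF fR] by (elim exE conjE) (rule that)
  have "A i x \<in> {..<v}" if "i < n" "x \<in> V" for i x
  proof -
    have "A i \<in> A ` {i. i < n}" using that(1) by (intro imageI CollectI)
    then have "A i \<in> ?R" by (simp only: A)
    then show ?thesis using that(2) by (rule PiE_mem)
  qed
  moreover have "\<exists>i<n. \<forall>x\<in>e. A i x = f x" if e: "e \<in> E" and f: "f \<in> e \<rightarrow>\<^sub>E {..<v}" for e f
  proof -
    let ?g = "\<lambda>x. if x \<in> e then f x else if x \<in> V then 0 else undefined"
    have "?g \<in> ?R" using e f sub assms(2) by (auto simp: PiE_iff extensional_def)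
    then have "?g \<in> A ` {i. i < n}" by (simp only: A)
    then obtain i where i: "i < n" "?g = A i" by (elim imageE CollectE)
    have "A i x = f x" if "x \<in> e" for x
      using fun_cong[OF i(2), of x] that by simp
    then show ?thesis using i(1) by blast
  qed
  ultimately show ?thesis unfolding VCA_def by blast
qed

end

theory Submission
  imports Defs "HOL-Probability.Product_PMF"
begin

text \<open>
  Choose the entries of an array with n rows independently and uniformly at random.
  The event that an edge with s vertices misses some tuple has probability at most
  v^s (1 - v^(-s))^n, hence at most v^t (1 - v^(-t))^n, and it is independent of the
  events of all edges disjoint from it.  For n at least the first bound this
  probability is at most 1 / (exp 1 (d + 1)), so the symmetric Lovasz local lemma
  yields an array avoiding all these events.
  The second inequality is ln (q / (q - 1)) \<ge> 1 / q for q = v^t.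
\<close>

section \<open>The Lovasz local lemma\<close>

lemma prod_superset_le:
  fixes f :: "'a \<Rightarrow> 'b :: linordered_idom"
  assumes "finite B" and "A \<subseteq> B" and "\<And>b. b \<in> B \<Longrightarrow> 0 \<le> f b \<and> f b \<le> 1"
  shows "prod f B \<le> prod f A"
proof -
  have "prod f B = prod f (B - A) * prod f A"
    using assms(2,1) by (rule prod.subset_diff)
  also have "\<dots> \<le> prod f A"
    using assms by (intro mult_left_le_one_le prod_nonneg prod_le_1) auto
  finally show ?thesis .
qed

context prob_space
begin

definition avoid :: "('i \<Rightarrow> 'a set) \<Rightarrow> 'i set \<Rightarrow> 'a set" where
  "avoid A S = space M - (\<Union>i\<in>S. A i)"

lemma avoid_empty: "avoid A {} = space M"
  by (simp add: avoid_def)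

lemma avoid_in_events: "finite S \<Longrightarrow> A ` S \<subseteq> events \<Longrightarrow> avoid A S \<in> events"
  unfolding avoid_def by (intro sets.compl_sets sets.finite_UN) auto

lemma avoid_antimono: "S \<subseteq> T \<Longrightarrow> avoid A T \<subseteq> avoid A S"
  unfolding avoid_def by blast

lemma prob_avoid_insert:
  assumes "finite S" and "A ` insert i S \<subseteq> events"
  shows "prob (avoid A (insert i S)) = prob (avoid A S) - prob (A i \<inter> avoid A S)"
proof -
  have "avoid A (insert i S) = avoid A S - A i"
    unfolding avoid_def by blast
  then show ?thesis
    using assms by (simp add: finite_measure_Diff' avoid_in_events Int_commute)
qed

lemma prob_avoid_Un_ge:
  fixes x :: "'i \<Rightarrow> real"
  assumes "finite S" and "finite T" and "A ` (S \<union> T) \<subseteq> events"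
    and "\<And>i. i \<in> T \<Longrightarrow> x i < 1"
    and "\<And>i U. i \<in> T \<Longrightarrow> U \<subseteq> T \<Longrightarrow> i \<notin> U \<Longrightarrow>
      prob (A i \<inter> avoid A (S \<union> U)) \<le> x i * prob (avoid A (S \<union> U))"
  shows "(\<Prod>i\<in>T. 1 - x i) * prob (avoid A S) \<le> prob (avoid A (S \<union> T))"
  using assms(2-)
proof (induction T rule: finite_induct)
  case empty
  then show ?case by simp
next
  case (insert i T)
  have IH: "(\<Prod>j\<in>T. 1 - x j) * prob (avoid A S) \<le> prob (avoid A (S \<union> T))"
    using insert.prems by (intro insert.IH) blast+
  have "(\<Prod>j\<in>insert i T. 1 - x j) * prob (avoid A S)
      = (1 - x i) * ((\<Prod>j\<in>T. 1 - x j) * prob (avoid A S))"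
    using insert.hyps by (simp add: mult.assoc)
  also have "\<dots> \<le> (1 - x i) * prob (avoid A (S \<union> T))"
    using IH insert.prems(2)[of i] by (intro mult_left_mono) auto
  also have "\<dots> \<le> prob (avoid A (S \<union> T)) - prob (A i \<inter> avoid A (S \<union> T))"
    using insert.prems(3)[of i T] insert.hyps(2) by (auto simp: algebra_simps)
  also have "\<dots> = prob (avoid A (S \<union> insert i T))"
    using prob_avoid_insert[of "S \<union> T" A i] assms(1) insert.hyps(1) insert.prems(1) by simp
  finally show ?case .
qed

end

text \<open>Mutual independence of each event from the family of its non-neighbours is only needed
  as an inequality (the lopsided form of the local lemma).\<close>

locale lopsidependency_graph = prob_space +
  fixes I :: "'i set" and A :: "'i \<Rightarrow> 'a set" and N :: "'i \<Rightarrow> 'i set"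
  assumes finite_vertices: "finite I"
    and events: "A ` I \<subseteq> events"
    and neighbours_subset: "i \<in> I \<Longrightarrow> N i \<subseteq> I"
    and lopsided: "i \<in> I \<Longrightarrow> S \<subseteq> I - insert i (N i) \<Longrightarrow>
      prob (A i \<inter> avoid A S) \<le> prob (A i) * prob (avoid A S)"
begin

context
  fixes x :: "'i \<Rightarrow> real"
  assumes weights: "\<And>i. i \<in> I \<Longrightarrow> x i \<in> {0..<1}"
    and prob_le_weights: "\<And>i. i \<in> I \<Longrightarrow> prob (A i) \<le> x i * (\<Prod>j\<in>N i. 1 - x j)"
begin

lemma prob_Int_avoid_le_prod:
  assumes "S \<subseteq> I" and "i \<in> I" and "i \<notin> S"
  shows "prob (A i \<inter> avoid A S) \<le> x i * (\<Prod>j\<in>S \<inter> N i. 1 - x j) * prob (avoid A (S - N i))"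
proof -
  have finite_S: "finite S"
    using assms(1) finite_vertices by (rule finite_subset)
  have subset_I: "N i \<subseteq> I"
    using assms(2) by (rule neighbours_subset)
  have "(\<Prod>j\<in>N i. 1 - x j) \<le> (\<Prod>j\<in>S \<inter> N i. 1 - x j)"
  proof (rule prod_superset_le)
    show "0 \<le> 1 - x j \<and> 1 - x j \<le> 1" if "j \<in> N i" for j
      using weights[of j] that subset_I by auto
  qed (use subset_I finite_vertices in \<open>auto intro: finite_subset\<close>)
  then have "x i * (\<Prod>j\<in>N i. 1 - x j) \<le> x i * (\<Prod>j\<in>S \<inter> N i. 1 - x j)"
    using weights[OF assms(2)] by (intro mult_left_mono) auto
  with prob_le_weights[OF assms(2)] have prob_le: "prob (A i) \<le> x i * (\<Prod>j\<in>S \<inter> N i. 1 - x j)"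
    by (rule order_trans)
  have "prob (A i \<inter> avoid A S) \<le> prob (A i \<inter> avoid A (S - N i))"
    using assms(1,2) finite_S events avoid_antimono[of "S - N i" S A]
    by (intro finite_measure_mono sets.Int avoid_in_events) auto
  also have "\<dots> \<le> prob (A i) * prob (avoid A (S - N i))"
    using assms by (intro lopsided) auto
  also have "\<dots> \<le> x i * (\<Prod>j\<in>S \<inter> N i. 1 - x j) * prob (avoid A (S - N i))"
    using prob_le by (intro mult_right_mono) auto
  finally show ?thesis .
qed

lemma prob_Int_avoid_le:
  assumes "S \<subseteq> I" and "i \<in> I" and "i \<notin> S"
  shows "prob (A i \<inter> avoid A S) \<le> x i * prob (avoid A S)"
  using assms
proof (induction "card S" arbitrary: S i rule: less_induct)
  case less
  have finite_S: "finite S"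
    using less.prems(1) finite_vertices by (rule finite_subset)
  have "(\<Prod>j\<in>S \<inter> N i. 1 - x j) * prob (avoid A (S - N i)) \<le> prob (avoid A (S - N i \<union> S \<inter> N i))"
  proof (rule prob_avoid_Un_ge)
    fix j U assume j: "j \<in> S \<inter> N i" and U: "U \<subseteq> S \<inter> N i" "j \<notin> U"
    have "S - N i \<union> U \<subset> S" and "j \<notin> S - N i \<union> U" using j U by auto
    moreover from this(1) have "card (S - N i \<union> U) < card S"
      using finite_S by (rule psubset_card_mono[rotated])
    ultimately show "prob (A j \<inter> avoid A (S - N i \<union> U)) \<le> x j * prob (avoid A (S - N i \<union> U))"
      using j less.prems(1) by (intro less.hyps) auto
  qed (use finite_S less.prems(1) events weights in auto)
  moreover have "S - N i \<union> S \<inter> N i = S" by blast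
  ultimately have "x i * ((\<Prod>j\<in>S \<inter> N i. 1 - x j) * prob (avoid A (S - N i))) \<le> x i * prob (avoid A S)"
    using weights[OF less.prems(2)] by (intro mult_left_mono) auto
  with prob_Int_avoid_le_prod[OF less.prems] show ?case
    by (simp add: mult.assoc)
qed

theorem lovasz_local: "(\<Prod>i\<in>I. 1 - x i) \<le> prob (avoid A I)"
  using prob_avoid_Un_ge[of "{}" I A x] prob_Int_avoid_le weights finite_vertices events
  by (simp add: avoid_empty prob_space subset_iff)

end

end

text \<open>The optimal weight 1 / (d + 1) is not less than 1 for d = 0.\<close>

lemma ex_local_lemma_weight:
  fixes d :: nat
  shows "\<exists>x\<in>{0..<1::real}. 1 \<le> exp 1 * (real d + 1) * (x * (1 - x) ^ d)"
proof (cases "d = 0")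
  case True
  have "exp (- 1) \<in> {0..<1::real}" and "exp 1 * exp (- 1) = (1::real)"
    by (simp_all flip: exp_add)
  with True show ?thesis by (intro bexI[of _ "exp (- 1)"]) auto
next
  case False
  define x where "x = 1 / (real d + 1)"
  have "exp 1 * (1 - x) ^ d = (exp (1 / real d) * (1 - x)) ^ d"
    using False by (simp add: power_mult_distrib flip: exp_of_nat_mult)
  moreover have "1 - x = real d / (real d + 1)"
    by (simp add: x_def field_simps)
  then have "1 = (1 + 1 / real d) * (1 - x)"
    using False by (simp add: field_simps)
  moreover have "(1 + 1 / real d) * (1 - x) \<le> exp (1 / real d) * (1 - x)"
    by (intro mult_right_mono exp_ge_add_one_self) (simp add: x_def)
  ultimately have "1 \<le> exp 1 * (1 - x) ^ d"
    by simp
  also have "\<dots> = exp 1 * (real d + 1) * (x * (1 - x) ^ d)"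
    by (simp add: x_def)
  finally show ?thesis
    using False by (intro bexI[of _ x]) (simp_all add: x_def)
qed

theorem (in lopsidependency_graph) lovasz_local_symmetric:
  assumes prob: "\<And>i. i \<in> I \<Longrightarrow> prob (A i) \<le> p"
    and degree: "\<And>i. i \<in> I \<Longrightarrow> card (N i) \<le> d"
    and "exp 1 * (real d + 1) * p \<le> 1"
  shows "0 < prob (avoid A I)"
proof -
  obtain x where x_range: "x \<in> {0..<1::real}"
    and weight: "1 \<le> exp 1 * (real d + 1) * (x * (1 - x) ^ d)"
    using ex_local_lemma_weight by blast
  have "exp 1 * (real d + 1) * p \<le> exp 1 * (real d + 1) * (x * (1 - x) ^ d)"
    using assms(3) weight by linarith
  then have p_le: "p \<le> x * (1 - x) ^ d"
    by (subst (asm) mult_le_cancel_left_pos) (auto intro: mult_pos_pos)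
  have "prob (A i) \<le> x * (\<Prod>j\<in>N i. 1 - x)" if "i \<in> I" for i
  proof -
    have "x * (1 - x) ^ d \<le> x * (1 - x) ^ card (N i)"
      using x_range degree[OF that] by (intro mult_left_mono power_decreasing) auto
    with prob[OF that] p_le show ?thesis by simp
  qed
  then have "(1 - x) ^ card I \<le> prob (avoid A I)"
    using lovasz_local[of "\<lambda>_. x"] x_range by simp
  moreover have "0 < (1 - x) ^ card I" using x_range by simp
  ultimately show ?thesis by linarith
qed

section \<open>Independent coordinates\<close>

definition determined_by :: "'a set \<Rightarrow> ('a \<Rightarrow> 'b) set \<Rightarrow> bool" where
  "determined_by K X \<longleftrightarrow> (\<forall>f g. (\<forall>k\<in>K. f k = g k) \<longrightarrow> (f \<in> X \<longleftrightarrow> g \<in> X))"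

lemma determined_byD: "determined_by K X \<Longrightarrow> (\<And>k. k \<in> K \<Longrightarrow> f k = g k) \<Longrightarrow> f \<in> X \<longleftrightarrow> g \<in> X"
  unfolding determined_by_def by blast

lemma determined_by_Compl: "determined_by K X \<Longrightarrow> determined_by K (- X)"
  unfolding determined_by_def by blast

lemma determined_by_INT:
  "(\<And>j. j \<in> J \<Longrightarrow> determined_by (K j) (X j)) \<Longrightarrow> determined_by (\<Union>j\<in>J. K j) (\<Inter>j\<in>J. X j)"
  unfolding determined_by_def by simp blast

lemma determined_by_UN:
  "(\<And>j. j \<in> J \<Longrightarrow> determined_by (K j) (X j)) \<Longrightarrow> determined_by (\<Union>j\<in>J. K j) (\<Union>j\<in>J. X j)"
  unfolding determined_by_def by simp blast

lemma measure_pair_pmf_Times: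
  "measure_pmf.prob (pair_pmf p q) (X \<times> Y) = measure_pmf.prob p X * measure_pmf.prob q Y"
proof -
  have "measure_pmf.prob (pair_pmf p q) (X \<times> Y)
      = measure_pmf.prob (pair_pmf p q) ((X \<inter> set_pmf p) \<times> (Y \<inter> set_pmf q))"
    by (simp add: Times_Int_Times flip: measure_Int_set_pmf[of "pair_pmf p q" "X \<times> Y"])
  then show ?thesis
    by (simp add: measure_pmf_prob_product measure_Int_set_pmf)
qed

lemma map_pair_Pi_pmf_merge:
  assumes "finite I"
  shows "map_pmf (\<lambda>(f, g) k. if k \<in> K then f k else g k)
      (pair_pmf (Pi_pmf I dflt p) (Pi_pmf I dflt p)) = Pi_pmf I dflt p"
    (is "map_pmf ?merge (pair_pmf ?P ?P) = _")
proof -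
  let ?restrict = "\<lambda>J f k. if k \<in> J then f k else dflt"
  have restrict: "Pi_pmf J dflt p = map_pmf (?restrict J) ?P" if "J \<subseteq> I" for J
    using assms that by (rule Pi_pmf_subset)
  have outside: "f k = dflt" if "f \<in> set_pmf ?P" and "k \<notin> I" for f k
    using set_Pi_pmf_subset[OF assms, of dflt p] that by auto
  have "?P = Pi_pmf (I \<inter> K \<union> (I - K)) dflt p"
    by (simp add: Int_Diff_Un)
  also have "\<dots> = map_pmf (\<lambda>(f, g) k. if k \<in> I \<inter> K then f k else g k)
      (pair_pmf (Pi_pmf (I \<inter> K) dflt p) (Pi_pmf (I - K) dflt p))"
    using assms by (intro Pi_pmf_union) auto
  also have "\<dots> = map_pmf (\<lambda>(f, g) k. if k \<in> I \<inter> K then f k else g k)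
      (pair_pmf (map_pmf (?restrict (I \<inter> K)) ?P) (map_pmf (?restrict (I - K)) ?P))"
    by (simp only: restrict[of "I \<inter> K"] restrict[of "I - K"] Int_lower1 Diff_subset)
  also have "\<dots> = map_pmf (\<lambda>(f, g) k. if k \<in> I \<inter> K then f k else ?restrict (I - K) g k) (pair_pmf ?P ?P)"
    by (simp add: map_pmf_comp case_prod_unfold cong: if_cong flip: map_pair)
  also have "\<dots> = map_pmf ?merge (pair_pmf ?P ?P)"
    by (intro map_pmf_cong refl) (auto simp: fun_eq_iff intro: outside[symmetric])
  finally show ?thesis ..
qed

lemma measure_Pi_pmf_Int:
  assumes "finite I" and determined_X: "determined_by K X" and determined_Y: "determined_by L Y"
    and "K \<inter> L = {}"
  shows "measure_pmf.prob (Pi_pmf I dflt p) (X \<inter> Y)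
    = measure_pmf.prob (Pi_pmf I dflt p) X * measure_pmf.prob (Pi_pmf I dflt p) Y"
    (is "measure_pmf.prob ?P _ = _")
proof -
  let ?merge = "\<lambda>(f, g) k. if k \<in> K then f k else g k"
  have "?merge (f, g) \<in> X \<longleftrightarrow> f \<in> X" for f g
    by (rule determined_byD[OF determined_X]) simp
  moreover have "?merge (f, g) \<in> Y \<longleftrightarrow> g \<in> Y" for f g
    by (rule determined_byD[OF determined_Y]) (use assms(4) in auto)
  ultimately have "?merge -` (X \<inter> Y) = X \<times> Y" by auto
  moreover have "measure_pmf.prob ?P (X \<inter> Y) = measure_pmf.prob (pair_pmf ?P ?P) (?merge -` (X \<inter> Y))"
    by (subst map_pair_Pi_pmf_merge[OF assms(1), of K, symmetric]) simp
  ultimately show ?thesis by (simp add: measure_pair_pmf_Times)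
qed

lemma measure_Pi_pmf_INT:
  assumes "finite I" and "finite J" and "disjoint_family_on K J"
    and "\<And>j. j \<in> J \<Longrightarrow> determined_by (K j) (X j)"
  shows "measure_pmf.prob (Pi_pmf I dflt p) (\<Inter>j\<in>J. X j)
    = (\<Prod>j\<in>J. measure_pmf.prob (Pi_pmf I dflt p) (X j))"
  using assms(2-)
proof (induction J rule: finite_induct)
  case empty
  then show ?case by simp
next
  case (insert j J)
  have "K j \<inter> (\<Union>i\<in>J. K i) = {}"
    using insert.prems(1) insert.hyps(2) by (fastforce simp: disjoint_family_on_def)
  then have "measure_pmf.prob (Pi_pmf I dflt p) (X j \<inter> (\<Inter>i\<in>J. X i))
      = measure_pmf.prob (Pi_pmf I dflt p) (X j) * measure_pmf.prob (Pi_pmf I dflt p) (\<Inter>i\<in>J. X i)"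
    using assms(1) insert.prems(2)
    by (intro measure_Pi_pmf_Int[where K = "K j" and L = "\<Union>i\<in>J. K i"] determined_by_INT) auto
  then show ?case
    using insert by (simp add: disjoint_family_on_insert)
qed

lemma measure_Pi_pmf_Pi_subset:
  assumes "finite I" and "J \<subseteq> I"
  shows "measure_pmf.prob (Pi_pmf I dflt p) (Pi J B) = (\<Prod>j\<in>J. measure_pmf.prob (p j) (B j))"
proof -
  have "Pi J B = Pi I (\<lambda>j. if j \<in> J then B j else UNIV)"
    using assms(2) by (fastforce simp: Pi_iff)
  then show ?thesis
    using assms
    by (simp add: measure_Pi_pmf_Pi if_distrib[of "measure_pmf.prob _"] prod.If_cases Int_absorb1)
qed

section \<open>Random arrays\<close>

definition random_array :: "nat \<Rightarrow> 'a set \<Rightarrow> nat \<Rightarrow> (nat \<times> 'a \<Rightarrow> nat) pmf" where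
  "random_array n V v = Pi_pmf ({..<n} \<times> V) 0 (\<lambda>_. pmf_of_set {..<v})"

definition row_extends :: "nat \<Rightarrow> 'a set \<Rightarrow> ('a \<Rightarrow> nat) \<Rightarrow> (nat \<times> 'a \<Rightarrow> nat) set" where
  "row_extends i e f = {A. \<forall>x\<in>e. A (i, x) = f x}"

definition uncovered :: "nat \<Rightarrow> nat \<Rightarrow> 'a set \<Rightarrow> (nat \<times> 'a \<Rightarrow> nat) set" where
  "uncovered n v e = (\<Union>f \<in> e \<rightarrow>\<^sub>E {..<v}. \<Inter>i<n. - row_extends i e f)"

lemma determined_by_row_extends: "determined_by ({i} \<times> e) (row_extends i e f)"
  unfolding determined_by_def row_extends_def by auto

lemma determined_by_uncovered: "determined_by (UNIV \<times> e) (uncovered n v e)"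
  unfolding determined_by_def uncovered_def row_extends_def by simp

lemma prob_row_extends:
  assumes "finite V" and "e \<subseteq> V" and "f \<in> e \<rightarrow> {..<v}" and "i < n"
  shows "measure_pmf.prob (random_array n V v) (row_extends i e f) = 1 / real v ^ card e"
proof -
  have row_extends: "row_extends i e f = Pi ({i} \<times> e) (\<lambda>c. {f (snd c)})"
    by (auto simp: row_extends_def Pi_iff)
  have "measure_pmf.prob (random_array n V v) (row_extends i e f)
      = (\<Prod>c\<in>{i} \<times> e. measure_pmf.prob (pmf_of_set {..<v}) {f (snd c)})"
    unfolding random_array_def row_extends
    using assms by (intro measure_Pi_pmf_Pi_subset) auto
  also have "\<dots> = (\<Prod>_\<in>{i} \<times> e. 1 / real v)"
    using assms(3) by (intro prod.cong) (auto simp: Pi_iff measure_pmf_single lessThan_empty_iff)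
  finally show ?thesis
    by (simp add: power_one_over card_cartesian_product)
qed

lemma prob_no_row_extends:
  assumes "finite V" and "e \<subseteq> V" and "f \<in> e \<rightarrow> {..<v}"
  shows "measure_pmf.prob (random_array n V v) (\<Inter>i<n. - row_extends i e f)
    = (1 - 1 / real v ^ card e) ^ n"
proof -
  have "measure_pmf.prob (random_array n V v) (\<Inter>i<n. - row_extends i e f)
      = (\<Prod>i<n. measure_pmf.prob (random_array n V v) (- row_extends i e f))"
    unfolding random_array_def using assms(1)
    by (intro measure_Pi_pmf_INT[where K = "\<lambda>i. {i} \<times> e"] determined_by_Compl determined_by_row_extends)
      (auto simp: disjoint_family_on_def)
  also have "\<dots> = (\<Prod>i<n. 1 - measure_pmf.prob (random_array n V v) (row_extends i e f))"
    using measure_pmf.prob_compl[of _ "random_array n V v"] by (simp add: Compl_eq_Diff_UNIV)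
  also have "\<dots> = (\<Prod>i<n. 1 - 1 / real v ^ card e)"
    using prob_row_extends[OF assms] by simp
  finally show ?thesis by simp
qed

lemma prob_uncovered_le:
  assumes "finite V" and "e \<subseteq> V" and "0 < v" and "card e \<le> t"
  shows "measure_pmf.prob (random_array n V v) (uncovered n v e)
    \<le> real v ^ t * (1 - 1 / real v ^ t) ^ n"
proof -
  have "finite e" using assms(1,2) by (rule finite_subset[rotated])
  then have "measure_pmf.prob (random_array n V v) (uncovered n v e)
      \<le> (\<Sum>f\<in>e \<rightarrow>\<^sub>E {..<v}. measure_pmf.prob (random_array n V v) (\<Inter>i<n. - row_extends i e f))"
    unfolding uncovered_def
    by (intro measure_pmf.finite_measure_subadditive_finite) (auto simp: finite_PiE)
  also have "\<dots> = (\<Sum>f\<in>e \<rightarrow>\<^sub>E {..<v}. (1 - 1 / real v ^ card e) ^ n)"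
    using assms(1,2) by (intro sum.cong prob_no_row_extends) (auto simp: PiE_def)
  also have "\<dots> = real v ^ card e * (1 - 1 / real v ^ card e) ^ n"
    using \<open>finite e\<close> by (simp add: card_PiE)
  also have "\<dots> \<le> real v ^ t * (1 - 1 / real v ^ t) ^ n"
    using assms(3,4)
    by (intro mult_mono power_mono diff_left_mono divide_left_mono power_increasing) auto
  finally show ?thesis .
qed

lemma VCA_curryI:
  assumes "A \<in> set_pmf (random_array n V v)" and "finite V" and "0 < v"
    and "\<And>e. e \<in> E \<Longrightarrow> A \<notin> uncovered n v e"
  shows "VCA n V E v (curry A)"
proof -
  have "A \<in> PiE_dflt ({..<n} \<times> V) 0 (\<lambda>_. {..<v})"
    using assms(1-3) by (simp add: random_array_def set_Pi_pmf comp_def lessThan_empty_iff)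
  then have "curry A i x \<in> {..<v}" if "i < n" "x \<in> V" for i x
    using that by (auto simp: PiE_dflt_def)
  moreover have "\<exists>i<n. \<forall>x\<in>e. curry A i x = f x" if "e \<in> E" "f \<in> e \<rightarrow>\<^sub>E {..<v}" for e f
    using assms(4)[OF that(1)] that(2) by (auto simp: uncovered_def row_extends_def)
  ultimately show ?thesis
    unfolding VCA_def by blast
qed

section \<open>The covering array number\<close>

definition intersecting_edges :: "'a set set \<Rightarrow> 'a set \<Rightarrow> 'a set set" where
  "intersecting_edges E e = {f \<in> E. f \<noteq> e \<and> f \<inter> e \<noteq> {}}"

lemma finite_hypergraph_finite_edges: "finite_hypergraph V E \<Longrightarrow> finite E"
  unfolding finite_hypergraph_def by (auto intro: finite_subset)

lemma card_edge_le_rank: "finite E \<Longrightarrow> e \<in> E \<Longrightarrow> card e \<le> hypergraph_rank E"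
  by (auto simp: hypergraph_rank_def)

lemma lopsidependency_graph_uncovered:
  assumes "finite_hypergraph V E"
  shows "lopsidependency_graph (random_array n V v) E (uncovered n v) (intersecting_edges E)"
proof (intro lopsidependency_graph.intro lopsidependency_graph_axioms.intro)
  fix e S assume disjoint: "S \<subseteq> E - insert e (intersecting_edges E e)"
  let ?P = "random_array n V v" and ?B = "uncovered n v"
  have "measure_pmf.avoid ?P ?B S = - (\<Union>f\<in>S. ?B f)"
    by (simp add: measure_pmf.avoid_def Compl_eq_Diff_UNIV)
  then have "determined_by (\<Union>f\<in>S. UNIV \<times> f) (measure_pmf.avoid ?P ?B S)"
    by (simp only: determined_by_Compl determined_by_UN determined_by_uncovered)
  moreover have "UNIV \<times> e \<inter> (\<Union>f\<in>S. UNIV \<times> f) = {}"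
    using disjoint by (auto simp: intersecting_edges_def)
  ultimately have "measure_pmf.prob ?P (?B e \<inter> measure_pmf.avoid ?P ?B S)
      = measure_pmf.prob ?P (?B e) * measure_pmf.prob ?P (measure_pmf.avoid ?P ?B S)"
    using assms unfolding random_array_def finite_hypergraph_def
    by (intro measure_Pi_pmf_Int[OF _ determined_by_uncovered]) auto
  then show "measure_pmf.prob ?P (?B e \<inter> measure_pmf.avoid ?P ?B S)
      \<le> measure_pmf.prob ?P (?B e) * measure_pmf.prob ?P (measure_pmf.avoid ?P ?B S)"
    by simp
qed (use assms in \<open>auto simp: measure_pmf.prob_space_axioms finite_hypergraph_finite_edges
  intersecting_edges_def\<close>)

lemma VCAN_le:
  fixes E :: "'a set set" and v :: nat
  defines "q \<equiv> real v ^ hypergraph_rank E"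
  assumes hypergraph: "finite_hypergraph V E" and "0 < v"
    and degree: "\<And>e. e \<in> E \<Longrightarrow> card (intersecting_edges E e) \<le> d"
    and failure: "exp 1 * (real d + 1) * (q * (1 - 1 / q) ^ n) \<le> 1"
  shows "VCAN V E v \<le> n"
proof -
  let ?P = "random_array n V v"
  have finite_V: "finite V" and edge_subset: "\<And>e. e \<in> E \<Longrightarrow> e \<subseteq> V"
    using hypergraph by (auto simp: finite_hypergraph_def)
  have "measure_pmf.prob ?P (uncovered n v e) \<le> q * (1 - 1 / q) ^ n" if "e \<in> E" for e
    unfolding q_def using finite_V edge_subset[OF that] \<open>0 < v\<close>
      card_edge_le_rank[OF finite_hypergraph_finite_edges[OF hypergraph] that]
    by (rule prob_uncovered_le)
  then have "0 < measure_pmf.prob ?P (measure_pmf.avoid ?P (uncovered n v) E)"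
    using degree failure
    by (rule lopsidependency_graph.lovasz_local_symmetric
        [OF lopsidependency_graph_uncovered[OF hypergraph]])
  then obtain A where "A \<in> set_pmf ?P" "A \<in> measure_pmf.avoid ?P (uncovered n v) E"
    by (metis disjoint_iff less_irrefl measure_pmf_zero_iff)
  then have "VCA n V E v (curry A)"
    using finite_V \<open>0 < v\<close> by (intro VCA_curryI) (auto simp: measure_pmf.avoid_def)
  then show ?thesis
    unfolding VCAN_def by (intro Least_le) blast
qed

lemma failure_probability_le:
  fixes q D :: real
  assumes "1 < q" and "0 < D" and "(ln D + ln q + 1) / ln (q / (q - 1)) \<le> real n"
  shows "exp 1 * D * (q * (1 - 1 / q) ^ n) \<le> 1"
proof -
  have "0 < ln (q / (q - 1))" using assms(1) by simp
  then have "ln D + ln q + 1 \<le> real n * ln (q / (q - 1))"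
    using assms(3) by (simp add: pos_divide_le_eq)
  then have "exp (ln D + ln q + 1) \<le> exp (real n * ln (q / (q - 1)))"
    by simp
  then have "exp 1 * D * q \<le> (q / (q - 1)) ^ n"
    using assms(1,2) by (simp add: exp_add exp_of_nat_mult mult_ac)
  then have "exp 1 * D * q * (1 - 1 / q) ^ n \<le> (q / (q - 1)) ^ n * (1 - 1 / q) ^ n"
    using assms(1) by (intro mult_right_mono) auto
  also have "\<dots> = 1"
    using assms(1) by (simp add: field_simps flip: power_mult_distrib)
  finally show ?thesis by (simp add: mult_ac)
qed

lemma VCAN_le_ceiling:
  fixes E :: "'a set set" and v :: nat
  defines "q \<equiv> real v ^ hypergraph_rank E"
  assumes "finite_hypergraph V E" and "1 < q"
    and "\<And>e. e \<in> E \<Longrightarrow> card (intersecting_edges E e) \<le> d"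
  shows "VCAN V E v \<le> nat \<lceil>(ln (real d + 1) + ln q + 1) / ln (q / (q - 1))\<rceil>" (is "_ \<le> ?n")
proof -
  have "0 < v"
    using \<open>1 < q\<close> unfolding q_def by (cases "v = 0") (simp_all add: power_0_left split: if_splits)
  moreover have "exp 1 * (real d + 1) * (q * (1 - 1 / q) ^ ?n) \<le> 1"
    using \<open>1 < q\<close> by (intro failure_probability_le real_nat_ceiling_ge) auto
  ultimately show ?thesis
    using assms(2,4) unfolding q_def by (intro VCAN_le)
qed

lemma inverse_le_ln_ratio:
  fixes q :: real
  assumes "1 < q"
  shows "1 / q \<le> ln (q / (q - 1))"
proof -
  have "1 / q = 1 - (q - 1) / q" using assms by (simp add: field_simps)
  also have "\<dots> \<le> - ln ((q - 1) / q)"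
    using ln_le_minus_one[of "(q - 1) / q"] assms by simp
  also have "\<dots> = ln (q / (q - 1))" using assms by (simp add: ln_div)
  finally show ?thesis .
qed

lemma divide_ln_ratio_le:
  fixes q c :: real
  assumes "1 < q" and "0 \<le> c"
  shows "c / ln (q / (q - 1)) \<le> q * c"
proof -
  have "c / ln (q / (q - 1)) \<le> c / (1 / q)"
    using assms inverse_le_ln_ratio[OF assms(1)] by (intro divide_left_mono) auto
  then show ?thesis by (simp add: mult.commute)
qed

theorem theorem2:
  fixes V :: "'a set" and E :: "'a set set" and t v :: nat and d :: int
  assumes "finite_hypergraph V E"
    and "hypergraph_rank E = t" and "t \<ge> 1"
    and "\<forall>e\<in>E. int (card {f\<in>E. f \<noteq> e \<and> f \<inter> e \<noteq> {}}) \<le> d"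
    and "v \<ge> 2"
  shows "int (VCAN V E v)
           \<le> \<lceil>(ln (real_of_int d + 1) + real t * ln (real v) + 1)
                / ln (real v ^ t / (real v ^ t - 1))\<rceil>
       \<and> \<lceil>(ln (real_of_int d + 1) + real t * ln (real v) + 1)
                / ln (real v ^ t / (real v ^ t - 1))\<rceil>
           \<le> \<lceil>real v ^ t * (ln (real_of_int d + 1) + real t * ln (real v) + 1)\<rceil>"
proof -
  have "E \<noteq> {}"
    using assms(2,3) by (auto simp: hypergraph_rank_def)
  then have "0 \<le> d"
    using assms(4) by (meson all_not_in_conv of_nat_0_le_iff order_trans)
  then obtain k where d: "d = int k"
    by (rule nonneg_int_cases)
  define q where "q = real v ^ t"
  define c where "c = ln (real k + 1) + ln q + 1"
  have q_gt_1: "1 < q"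
    unfolding q_def using assms(3,5) by (intro one_less_power) auto
  then have c_nonneg: "0 \<le> c" and c_eq: "c = ln (real_of_int d + 1) + real t * ln (real v) + 1"
    using assms(5) by (simp_all add: c_def q_def d ln_realpow)
  have "VCAN V E v \<le> nat \<lceil>c / ln (q / (q - 1))\<rceil>"
    using VCAN_le_ceiling[of V E v k] assms q_gt_1
    by (simp add: c_def q_def d intersecting_edges_def)
  moreover have "0 \<le> c / ln (q / (q - 1))"
    using q_gt_1 c_nonneg by (intro divide_nonneg_pos) simp_all
  moreover have "\<lceil>c / ln (q / (q - 1))\<rceil> \<le> \<lceil>q * c\<rceil>"
    using q_gt_1 c_nonneg by (intro ceiling_mono divide_ln_ratio_le)
  ultimately show ?thesis
    unfolding c_eq q_def by linarith
qed

end
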